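(* Let $f=(f_k)_{k\ge1}$ be a parameter of association for which Properties 1 and 2 hold. Then Property 3 (directional collapsibility) holds for $f$ if and only if, for every $k\ge1$ and every distribution $(p(t):t\in T_k)$ on $T_k=\{1,2\}^k$, $$\operatorname{sgn}\bigl(f_k(p(t):t\in T_k)\bigr)=\operatorname{sgn}\bigl(DI_k(p(t):t\in T_k)\bigr).$$
   Context: A distribution on $T_k=\{1,2\}^k$ (the table of the binary variables $V_1,\dots,V_k$) is any family $(p(t):t\in T_k)$ of strictly positive real numbers (not necessarily summing to $1$). A parameter of association is given by real-valued functions $f_k$ on the set of distributions on $T_k$, one for each $k\ge1$; Properties 1 and 2 are required for every $k\ge 1$. Here $\operatorname{sgn}$ takes values in $\{-1,0,1\}$. Property 1: $f_k$ is continuous, $f_k(p(t):t\in T_k)=0$ if $p(t)=c$ for all $t\in T_k$ (for any constant $c>0$), and $f_k$ is strictly increasing in the entry $p(1,1,\ldots,1)$ (the other entries being fixed). Property 2: if $p$ and $q$ are distributions on $T_k$ such that there is an $i\in\{1,\ldots,k\}$ with $$p(j_1,\ldots,j_{i-1},j_i,j_{i+1},\ldots,j_k)=q(j_1,\ldots,j_{i-1},j_i^*,j_{i+1},\ldots,j_k),\qquad j_i^*+j_i=3,$$ for all cells $(j_1,\ldots,j_k)\in T_k$ (i.e. $q$ is obtained from $p$ by swapping the two categories of $V_i$), then $\operatorname{sgn}(f_k(p))=-\operatorname{sgn}(f_k(q))$. Property 3 (directional collapsibility): for every $k\ge 2$, every distribution $p$ on $T_k$ and every $i\in\{1,\ldots,k\}$,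 if $$\operatorname{sgn} f_{k-1}(p(t):t\in T_{k-1}(V_i=1))=\operatorname{sgn} f_{k-1}(p(t):t\in T_{k-1}(V_i=2)),$$ then $\operatorname{sgn} f_{k-1}(p(t):t\in T_{k-1}(V_i=+))$ is equal to this common value. Here $T_{k-1}(V_i=j)$ is the $(k-1)$-dimensional table of the variables other than $V_i$ consisting of the cells of $T_k$ with $i$-th index $j$ (with the entries of $p$ in these cells), and $T_{k-1}(V_i=+)$ is the table obtained by collapsing (marginalizing) over $V_i$, i.e. its entries are the sums of the corresponding entries for $V_i=1$ and $V_i=2$. $DI_k(p)=\sum_{t\in T_{ke}}p(t)-\sum_{t\in T_{ko}}p(t)$, where $T_{ke}$ (resp. $T_{ko}$) is the set of cells $t\in T_k$ with an even (resp. odd) number of coordinates equal to $2$. *)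

theory Defs
  imports "HOL-Analysis.Analysis"
begin

definition cells :: "nat \<Rightarrow> nat list set" where
  "cells k = {t. length t = k \<and> set t \<subseteq> {1, 2}}"

text \<open>Distributions are extensional functions (\<^term>\<open>undefined\<close> outside the table), so they are in
  bijection with the families of positive reals indexed by the cells. The product topology on
  \<^typ>\<open>nat list \<Rightarrow> real\<close> then induces the Euclidean topology on \<open>distributions k\<close>.\<close>

definition distributions :: "nat \<Rightarrow> (nat list \<Rightarrow> real) set" where
  "distributions k = cells k \<rightarrow>\<^sub>E {0<..}"

text \<open>A parameter of association is a family \<open>f\<close> where only the values of \<open>f k\<close> on
  \<open>distributions k\<close> for \<open>k \<ge> 1\<close> matter. Variables are numbered from 1, while list positions are
  numbered from 0, so the index of the i-th variable is at list position \<open>i - 1\<close>.\<close>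

definition swap_category :: "nat \<Rightarrow> nat list \<Rightarrow> nat list" where
  "swap_category i t = t[i - 1 := 3 - t ! (i - 1)]"

definition insert_index :: "nat \<Rightarrow> nat \<Rightarrow> nat list \<Rightarrow> nat list" where
  "insert_index i j t = take (i - 1) t @ j # drop (i - 1) t"

text \<open>Conditional and marginal tables of a distribution on the k-dimensional table; the remaining
  variables keep their order.\<close>

definition slice :: "nat \<Rightarrow> nat \<Rightarrow> nat \<Rightarrow> (nat list \<Rightarrow> real) \<Rightarrow> nat list \<Rightarrow> real" where
  "slice k i j p = (\<lambda>t\<in>cells (k - 1). p (insert_index i j t))"

definition collapse :: "nat \<Rightarrow> nat \<Rightarrow> (nat list \<Rightarrow> real) \<Rightarrow> nat list \<Rightarrow> real" where
  "collapse k i p =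
    (\<lambda>t\<in>cells (k - 1). p (insert_index i 1 t) + p (insert_index i 2 t))"

definition property1 :: "(nat \<Rightarrow> (nat list \<Rightarrow> real) \<Rightarrow> real) \<Rightarrow> bool" where
  "property1 f \<longleftrightarrow> (\<forall>k\<ge>1.
     continuous_on (distributions k) (f k) \<and>
     (\<forall>p\<in>distributions k. \<forall>c>0. (\<forall>t\<in>cells k. p t = c) \<longrightarrow> f k p = 0) \<and>
     (\<forall>p\<in>distributions k. \<forall>q\<in>distributions k.
        (\<forall>t\<in>cells k - {replicate k 1}. p t = q t) \<longrightarrow>
        p (replicate k 1) < q (replicate k 1) \<longrightarrow> f k p < f k q))"

definition property2 :: "(nat \<Rightarrow> (nat list \<Rightarrow> real) \<Rightarrow> real) \<Rightarrow> bool" where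
  "property2 f \<longleftrightarrow> (\<forall>k\<ge>1. \<forall>p\<in>distributions k. \<forall>q\<in>distributions k.
     (\<exists>i\<in>{1..k}. \<forall>t\<in>cells k. p t = q (swap_category i t)) \<longrightarrow>
     sgn (f k p) = - sgn (f k q))"

definition directionally_collapsible :: "(nat \<Rightarrow> (nat list \<Rightarrow> real) \<Rightarrow> real) \<Rightarrow> bool" where
  "directionally_collapsible f \<longleftrightarrow> (\<forall>k\<ge>2. \<forall>p\<in>distributions k. \<forall>i\<in>{1..k}.
     sgn (f (k - 1) (slice k i 1 p)) = sgn (f (k - 1) (slice k i 2 p)) \<longrightarrow>
     sgn (f (k - 1) (collapse k i p)) = sgn (f (k - 1) (slice k i 1 p)))"

definition even_cells :: "nat \<Rightarrow> nat list set" where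
  "even_cells k = {t \<in> cells k. even (count_list t 2)}"

definition odd_cells :: "nat \<Rightarrow> nat list set" where
  "odd_cells k = {t \<in> cells k. odd (count_list t 2)}"

definition DI :: "nat \<Rightarrow> (nat list \<Rightarrow> real) \<Rightarrow> real" where
  "DI k p = (\<Sum>t\<in>even_cells k. p t) - (\<Sum>t\<in>odd_cells k. p t)"

end

theory Submission imports Defs begin

text \<open>
  If Property 3 holds, then each of the three sign classes of \<open>f\<^sub>k\<close> is closed under addition, because
  any two tables on \<open>T\<^sub>k\<close> are the two slices of one table on \<open>T\<^sub>k\<^sub>+\<^sub>1\<close> (\<open>sgn_table_add\<close>). By Property 2,
  swapping the categories of an even number of variables preserves the sign of \<open>f\<^sub>k\<close>
  (\<open>sgn_translate\<close>). Hence the sum of all tables obtained from \<open>p\<close> by an even set of swaps has the same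
  sign as \<open>p\<close>. In this sum each even cell receives the total \<open>E\<close> of \<open>p\<close> over the even cells and each odd
  cell the total \<open>O\<close> over the odd cells, since the even swaps act simply transitively on both classes.
  So the sign of \<open>f\<^sub>k(p)\<close> depends on \<open>E\<close> and \<open>O\<close> only (\<open>sgn_eq_if_parity_sums_eq\<close>).

  It remains to look at one table for each pair \<open>(E, O)\<close>. If \<open>E \<ge> O\<close>, take the constant table whose odd
  total is \<open>O\<close> and raise its entry in \<open>(1,\<dots>,1)\<close> by \<open>E - O\<close>; Property 1 gives the sign. The case
  \<open>E < O\<close> follows by swapping the categories of one variable, which exchanges \<open>E\<close> and \<open>O\<close>.
  The converse holds because \<open>DI\<close> of a marginal table is the sum of \<open>DI\<close> of its two slices.
\<close>

section \<open>The group of category swaps\<close>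

text \<open>Cells form the group \<open>(\<int>/2)\<^sup>k\<close> with unit \<open>(1,\<dots>,1)\<close>. Adding \<open>s\<close> swaps the categories of exactly
  those variables at which \<open>s\<close> has the entry 2.\<close>

definition cell_add :: "nat list \<Rightarrow> nat list \<Rightarrow> nat list" where
  "cell_add s t = map2 (\<lambda>a b. if a = b then 1 else 2) s t"

definition parity_class :: "nat \<Rightarrow> bool \<Rightarrow> nat list set" where
  "parity_class k b = {t \<in> cells k. even (count_list t 2) = b}"

lemma even_cells_eq: "even_cells k = parity_class k True"
  and odd_cells_eq: "odd_cells k = parity_class k False"
  by (auto simp: even_cells_def odd_cells_def parity_class_def)

lemma finite_cells: "finite (cells k)"
  using finite_lists_length_eq[of "{1, 2 :: nat}" k] by (simp add: cells_def conj_commute)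

lemma finite_parity_class: "finite (parity_class k b)"
  by (rule finite_subset[OF _ finite_cells[of k]]) (auto simp: parity_class_def)

lemma replicate_1_in_cells: "replicate k 1 \<in> cells k"
  by (auto simp: cells_def)

lemma replicate_1_in_even: "replicate k 1 \<in> parity_class k True"
  using replicate_1_in_cells by (simp add: parity_class_def count_list_0_iff)

lemma odd_cell_in_odd: "k \<ge> 1 \<Longrightarrow> 2 # replicate (k - 1) 1 \<in> parity_class k False"
  by (auto simp: parity_class_def cells_def count_list_0_iff)

lemma cell_add_in_cells: "s \<in> cells k \<Longrightarrow> t \<in> cells k \<Longrightarrow> cell_add s t \<in> cells k"
  by (auto simp: cells_def cell_add_def)

lemma cell_add_commute: "length s = length t \<Longrightarrow> cell_add s t = cell_add t s"
  unfolding cell_add_def by (induction s t rule: list_induct2) auto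

lemma cell_add_cancel:
  assumes "s \<in> cells k" "t \<in> cells k"
  shows "cell_add (cell_add s t) t = s"
proof -
  have "length s = length t" using assms by (simp add: cells_def)
  moreover have "set s \<subseteq> {1, 2}" "set t \<subseteq> {1, 2}" using assms by (auto simp: cells_def)
  ultimately show ?thesis
    unfolding cell_add_def by (induction s t rule: list_induct2) auto
qed

lemma even_count_cell_add:
  assumes "s \<in> cells k" "t \<in> cells k"
  shows "even (count_list (cell_add s t) 2) \<longleftrightarrow>
    (even (count_list s 2) \<longleftrightarrow> even (count_list t 2))"
proof -
  have "length s = length t" using assms by (simp add: cells_def)
  moreover have "set s \<subseteq> {1, 2}" "set t \<subseteq> {1, 2}" using assms by (auto simp: cells_def)
  ultimately show ?thesis
    unfolding cell_add_def by (induction s t rule: list_induct2) auto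
qed

text \<open>Adding a fixed cell \<open>t\<close> permutes the cells, and it preserves or exchanges the two parity classes
  according to the parity of \<open>t\<close>.\<close>

lemma sum_parity_class_cell_add:
  assumes "t \<in> cells k"
  shows "(\<Sum>s\<in>parity_class k b. g (cell_add s t)) =
    sum g (parity_class k (b \<longleftrightarrow> even (count_list t 2)))"
  by (rule sum.reindex_bij_witness[where i = "\<lambda>u. cell_add u t" and j = "\<lambda>s. cell_add s t"])
     (use assms in \<open>auto simp: parity_class_def cell_add_cancel cell_add_in_cells
        even_count_cell_add\<close>)

lemma card_parity_classes_eq:
  assumes "k \<ge> 1"
  shows "card (parity_class k True) = card (parity_class k False)"
proof -
  have "2 # replicate (k - 1) 1 \<in> cells k" "odd (count_list (2 # replicate (k - 1) 1) (2::nat))"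
    using odd_cell_in_odd[OF assms] by (simp_all add: parity_class_def)
  then show ?thesis
    using sum_parity_class_cell_add[of "2 # replicate (k - 1) 1" k "\<lambda>_. 1::nat" True] by simp
qed

section \<open>Signs under category swaps\<close>

definition translate :: "nat \<Rightarrow> nat list \<Rightarrow> (nat list \<Rightarrow> real) \<Rightarrow> nat list \<Rightarrow> real" where
  "translate k s p = (\<lambda>t\<in>cells k. p (cell_add s t))"

lemma restrict_in_distributions:
  "(\<And>t. t \<in> cells k \<Longrightarrow> p t > 0) \<Longrightarrow> (\<lambda>t\<in>cells k. p t) \<in> distributions k"
  by (auto simp: distributions_def)

lemma distributions_pos: "p \<in> distributions k \<Longrightarrow> t \<in> cells k \<Longrightarrow> p t > 0"
  by (auto simp: distributions_def PiE_def Pi_def)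

lemma distributions_eqI:
  "p \<in> distributions k \<Longrightarrow> q \<in> distributions k \<Longrightarrow> (\<And>t. t \<in> cells k \<Longrightarrow> p t = q t) \<Longrightarrow> p = q"
  unfolding distributions_def by (rule PiE_ext)

lemma translate_in_distributions:
  "p \<in> distributions k \<Longrightarrow> s \<in> cells k \<Longrightarrow> translate k s p \<in> distributions k"
  unfolding translate_def
  by (intro restrict_in_distributions) (auto intro: distributions_pos cell_add_in_cells)

lemma translate_unit:
  assumes "p \<in> distributions k"
  shows "translate k (replicate k 1) p = p"
proof (rule distributions_eqI[OF translate_in_distributions[OF assms replicate_1_in_cells] assms])
  fix t assume t: "t \<in> cells k"
  have "cell_add (replicate (length t) 1) t = t" if "set t \<subseteq> {1, 2}"
    using that by (induction t) (auto simp: cell_add_def)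
  with t show "translate k (replicate k 1) p t = p t"
    by (auto simp: translate_def cells_def)
qed

lemma swap_category_in_cells:
  assumes "t \<in> cells k" "i \<in> {1..k}"
  shows "swap_category i t \<in> cells k"
proof -
  have "t ! (i - 1) \<in> set t" using assms by (auto simp: cells_def)
  then have "3 - t ! (i - 1) \<in> {1, 2}" using assms by (auto simp: cells_def)
  then show ?thesis
    using assms set_update_subset_insert[of t "i - 1" "3 - t ! (i - 1)"]
    by (auto simp: cells_def swap_category_def)
qed

lemma cell_add_swap_category:
  assumes "a @ 2 # s \<in> cells k" "t \<in> cells k"
  shows "cell_add (a @ 2 # s) t = cell_add (a @ 1 # s) (swap_category (Suc (length a)) t)"
proof -
  have "length t = length a + Suc (length s)" "set t \<subseteq> {1, 2}"
    using assms by (auto simp: cells_def)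
  then show ?thesis
  proof (induction a arbitrary: t)
    case Nil
    then show ?case by (cases t) (auto simp: cell_add_def swap_category_def)
  next
    case (Cons x a)
    then obtain b t' where "t = b # t'" by (cases t) auto
    with Cons show ?case by (simp add: cell_add_def swap_category_def)
  qed
qed

text \<open>The swaps encoded by \<open>s\<close> are performed one variable at a time, from the last variable to the first;
  \<open>n\<close> is the number of variables that have not been treated yet.\<close>

lemma sgn_translate_suffix:
  assumes "property2 f" "k \<ge> 1" "p \<in> distributions k"
  shows "n + length s = k \<Longrightarrow> set s \<subseteq> {1, 2} \<Longrightarrow>
    sgn (f k (translate k (replicate n 1 @ s) p)) = (- 1) ^ count_list s 2 * sgn (f k p)"
proof (induction s arbitrary: n)
  case Nil
  then show ?case using translate_unit[OF assms(3)] by simp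
next
  case (Cons x s)
  let ?a = "replicate n (1::nat)"
  have cells: "?a @ 1 # s \<in> cells k" "?a @ 2 # s \<in> cells k"
    using Cons.prems by (auto simp: cells_def)
  have IH: "sgn (f k (translate k (?a @ 1 # s) p)) = (- 1) ^ count_list s 2 * sgn (f k p)"
    using Cons.IH[of "Suc n"] Cons.prems by (simp add: replicate_app_Cons_same)
  show ?case
  proof (cases "x = 1")
    case True
    with IH show ?thesis by simp
  next
    case False
    with Cons.prems have x: "x = 2" by simp
    have n: "Suc n \<in> {1..k}" using Cons.prems by simp
    have "\<forall>t\<in>cells k. translate k (?a @ 2 # s) p t =
        translate k (?a @ 1 # s) p (swap_category (Suc n) t)"
      using cell_add_swap_category[OF cells(2)] swap_category_in_cells[OF _ n]
      by (simp add: translate_def)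
    with assms n cells translate_in_distributions[OF assms(3)]
    have "sgn (f k (translate k (?a @ 2 # s) p)) = - sgn (f k (translate k (?a @ 1 # s) p))"
      unfolding property2_def by blast
    with IH x show ?thesis by simp
  qed
qed

lemma sgn_translate:
  assumes "property2 f" "k \<ge> 1" "p \<in> distributions k" "s \<in> cells k"
  shows "sgn (f k (translate k s p)) = (- 1) ^ count_list s 2 * sgn (f k p)"
  using sgn_translate_suffix[OF assms(1-3), of 0 s] assms(4) by (simp add: cells_def)

section \<open>Collapsibility makes the sign classes additive\<close>

text \<open>Collapsing the table whose slices are \<open>p\<close> and \<open>q\<close> yields \<open>p + q\<close>.\<close>

lemma sgn_table_add:
  assumes f: "directionally_collapsible f" and k: "k \<ge> 1"
    and p: "p \<in> distributions k" and q: "q \<in> distributions k"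
    and eq: "sgn (f k p) = sgn (f k q)"
  shows "sgn (f k (\<lambda>t\<in>cells k. p t + q t)) = sgn (f k p)"
proof -
  define r where "r = (\<lambda>u\<in>cells (Suc k). if hd u = 1 then p (tl u) else q (tl u))"
  have cons: "j # t \<in> cells (Suc k)" if "t \<in> cells k" "j \<in> {1, 2}" for j t
    using that by (auto simp: cells_def)
  have tl: "tl u \<in> cells k" if "u \<in> cells (Suc k)" for u
    using that by (cases u) (auto simp: cells_def)
  have r: "r \<in> distributions (Suc k)"
    unfolding r_def
    by (intro restrict_in_distributions) (auto intro: distributions_pos[OF p] distributions_pos[OF q] tl)
  have rp: "slice (Suc k) 1 1 r = p"
    using p cons by (auto simp: slice_def insert_index_def r_def fun_eq_iff distributions_def
        PiE_def extensional_def)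
  have rq: "slice (Suc k) 1 2 r = q"
    using q cons by (auto simp: slice_def insert_index_def r_def fun_eq_iff distributions_def
        PiE_def extensional_def)
  have rs: "collapse (Suc k) 1 r = (\<lambda>t\<in>cells k. p t + q t)"
    using cons by (auto simp: collapse_def insert_index_def r_def fun_eq_iff)
  have "Suc k \<ge> 2" "1 \<in> {1..Suc k}" using k by auto
  with f r have "sgn (f (Suc k - 1) (slice (Suc k) 1 1 r)) = sgn (f (Suc k - 1) (slice (Suc k) 1 2 r)) \<longrightarrow>
      sgn (f (Suc k - 1) (collapse (Suc k) 1 r)) = sgn (f (Suc k - 1) (slice (Suc k) 1 1 r))"
    unfolding directionally_collapsible_def by blast
  with eq show ?thesis unfolding rp rq rs by simp
qed

lemma sgn_table_sum:
  assumes f: "directionally_collapsible f" and k: "k \<ge> 1" and "finite S" "S \<noteq> {}"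
    and "\<And>s. s \<in> S \<Longrightarrow> P s \<in> distributions k" "\<And>s. s \<in> S \<Longrightarrow> sgn (f k (P s)) = c"
  shows "sgn (f k (\<lambda>t\<in>cells k. \<Sum>s\<in>S. P s t)) = c"
  using assms(3-)
proof (induction S rule: finite_ne_induct)
  case (singleton x)
  then have "(\<lambda>t\<in>cells k. \<Sum>s\<in>{x}. P s t) = P x"
    by (intro distributions_eqI[of _ k] restrict_in_distributions) (auto intro: distributions_pos)
  with singleton show ?case by simp
next
  case (insert x S)
  let ?q = "\<lambda>t\<in>cells k. \<Sum>s\<in>S. P s t"
  have q: "?q \<in> distributions k"
    using insert by (intro restrict_in_distributions sum_pos) (auto intro: distributions_pos)
  have "(\<lambda>t\<in>cells k. \<Sum>s\<in>insert x S. P s t) = (\<lambda>t\<in>cells k. P x t + ?q t)"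
    using insert by (auto simp: fun_eq_iff)
  moreover have "sgn (f k (\<lambda>t\<in>cells k. P x t + ?q t)) = sgn (f k (P x))"
  proof (rule sgn_table_add[OF f k _ q])
    show "sgn (f k (P x)) = sgn (f k ?q)" using insert by (simp del: restrict_apply)
  qed (use insert.prems in simp)
  ultimately show ?case using insert.prems(2)[OF insertI1] by (simp only:)
qed

text \<open>Summing over all even swaps replaces every entry by the total over its parity class, and
  this sum determines the sign.\<close>

lemma sgn_eq_if_parity_sums_eq:
  assumes f: "directionally_collapsible f" "property2 f" and k: "k \<ge> 1"
    and p: "p \<in> distributions k" and q: "q \<in> distributions k"
    and eq: "\<And>b. sum p (parity_class k b) = sum q (parity_class k b)"
  shows "sgn (f k p) = sgn (f k q)"
proof -
  let ?S = "parity_class k True"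
  have sgn_sum: "sgn (f k (\<lambda>t\<in>cells k. sum r (parity_class k (even (count_list t 2))))) =
      sgn (f k r)" if r: "r \<in> distributions k" for r
  proof -
    have "(\<Sum>s\<in>?S. translate k s r t) = sum r (parity_class k (even (count_list t 2)))"
      if "t \<in> cells k" for t
      using sum_parity_class_cell_add[OF that, of r True] that by (simp add: translate_def)
    then have "(\<lambda>t\<in>cells k. sum r (parity_class k (even (count_list t 2)))) =
        (\<lambda>t\<in>cells k. \<Sum>s\<in>?S. translate k s r t)"
      by (auto simp: fun_eq_iff)
    moreover have "sgn (f k (\<lambda>t\<in>cells k. \<Sum>s\<in>?S. translate k s r t)) = sgn (f k r)"
    proof (rule sgn_table_sum[OF f(1) k finite_parity_class])
      show "?S \<noteq> {}" using replicate_1_in_even by blast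
    qed (use r in \<open>auto simp: parity_class_def sgn_translate[OF f(2) k]
        intro: translate_in_distributions\<close>)
    ultimately show ?thesis by simp
  qed
  show ?thesis
    using sgn_sum[OF p] sgn_sum[OF q] by (simp add: eq)
qed

section \<open>Comparison with the DI parameter\<close>

lemma DI_eq: "DI k p = sum p (parity_class k True) - sum p (parity_class k False)"
  by (simp add: DI_def even_cells_eq odd_cells_eq)

text \<open>The comparison table \<open>r\<close> is constant except for a raised entry in \<open>(1,\<dots>,1)\<close>, so Property 1
  determines its sign. It is chosen with the same parity totals as \<open>p\<close>; the raised entry stays positive
  because \<open>DI\<close> is nonnegative.\<close>

lemma sgn_eq_if_DI_nonneg:
  assumes f: "directionally_collapsible f" "property1 f" "property2 f" and k: "k \<ge> 1"
    and p: "p \<in> distributions k" and nonneg: "DI k p \<ge> 0"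
  shows "sgn (f k p) = sgn (DI k p)"
proof -
  let ?o = "replicate k (1::nat)"
  define N where "N = card (parity_class k False)"
  \<comment> \<open>This constant gives the odd total of \<open>p\<close>. Both parity classes have \<open>N\<close> cells, so it
    gives the same even total, and raising one even entry by \<open>DI k p\<close> corrects that total.\<close>
  define c where "c = sum p (parity_class k False) / real N"
  define q where "q = (\<lambda>t\<in>cells k. c)"
  define r where "r = (\<lambda>t\<in>cells k. if t = ?o then c + DI k p else c)"
  have odd_nonempty: "parity_class k False \<noteq> {}"
    using odd_cell_in_odd[OF k] by blast
  have N: "N > 0" "card (parity_class k True) = N"
    using odd_nonempty finite_parity_class card_parity_classes_eq[OF k] by (auto simp: N_def card_gt_0_iff)
  have "sum p (parity_class k False) > 0"
    by (intro sum_pos finite_parity_class odd_nonempty distributions_pos[OF p])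
       (simp add: parity_class_def)
  then have c: "c > 0" using N by (simp add: c_def)
  have q: "q \<in> distributions k" unfolding q_def using c by (intro restrict_in_distributions)
  have r: "r \<in> distributions k"
    unfolding r_def using c nonneg by (intro restrict_in_distributions) auto
  have "f k q = 0" using f(2) k q c by (auto simp: property1_def q_def)
  moreover have "f k q < f k r" if "DI k p > 0"
  proof -
    have "\<forall>t\<in>cells k - {?o}. q t = r t" "q ?o < r ?o"
      using that replicate_1_in_cells by (auto simp: q_def r_def)
    with f(2) k q r show ?thesis unfolding property1_def by blast
  qed
  moreover have "q = r" if "DI k p = 0"
    using that by (auto simp: q_def r_def fun_eq_iff)
  ultimately have "sgn (f k r) = sgn (DI k p)"
    using nonneg by (cases "DI k p = 0") auto
  moreover have "sum r (parity_class k b) = sum p (parity_class k b)" for b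
  proof -
    have sum_r: "sum r (parity_class k b) = real (card (parity_class k b)) * c +
        (if ?o \<in> parity_class k b then DI k p else 0)" for b
    proof -
      have "sum r (parity_class k b) =
          (\<Sum>t\<in>parity_class k b. c + (if t = ?o then DI k p else 0))"
        by (intro sum.cong) (auto simp: r_def parity_class_def)
      then show ?thesis
        by (simp add: sum.distrib sum.delta finite_parity_class)
    qed
    have "?o \<notin> parity_class k False"
      using replicate_1_in_even by (auto simp: parity_class_def)
    then show ?thesis
      using sum_r[of b] N replicate_1_in_even[of k]
      by (cases b) (auto simp: c_def DI_eq N_def[symmetric])
  qed
  then have "sgn (f k p) = sgn (f k r)"
    by (intro sgn_eq_if_parity_sums_eq[OF f(1) f(3) k p r]) simp
  ultimately show ?thesis by simp
qed

text \<open>An odd set of swaps exchanges the two parity classes, hence their totals.\<close>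

lemma DI_translate:
  assumes "s \<in> parity_class k False"
  shows "DI k (translate k s p) = - DI k p"
proof -
  have s: "s \<in> cells k" "odd (count_list s 2)" using assms by (auto simp: parity_class_def)
  have "sum (translate k s p) (parity_class k b) = sum p (parity_class k (\<not> b))" for b
  proof -
    have "sum (translate k s p) (parity_class k b) = (\<Sum>t\<in>parity_class k b. p (cell_add t s))"
      using s(1) by (intro sum.cong) (auto simp: parity_class_def translate_def cells_def cell_add_commute)
    with sum_parity_class_cell_add[OF s(1), of p b] s(2) show ?thesis by simp
  qed
  then show ?thesis by (simp add: DI_eq)
qed

lemma sgn_eq_sgn_DI:
  assumes f: "directionally_collapsible f" "property1 f" "property2 f" and k: "k \<ge> 1"
    and p: "p \<in> distributions k"
  shows "sgn (f k p) = sgn (DI k p)"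
proof (cases "DI k p \<ge> 0")
  case True
  with sgn_eq_if_DI_nonneg[OF f k p] show ?thesis .
next
  case False
  \<comment> \<open>Swapping the categories of the first variable makes \<open>DI\<close> positive.\<close>
  define s where "s = 2 # replicate (k - 1) (1::nat)"
  have s: "s \<in> parity_class k False" using odd_cell_in_odd[OF k] by (simp add: s_def)
  then have s': "s \<in> cells k" "odd (count_list s 2)" by (auto simp: parity_class_def)
  have "sgn (f k (translate k s p)) = sgn (DI k (translate k s p))"
    using False by (intro sgn_eq_if_DI_nonneg[OF f k translate_in_distributions[OF p s'(1)]])
      (simp add: DI_translate[OF s])
  then show ?thesis
    using s' by (simp add: sgn_translate[OF f(3) k p] DI_translate[OF s] sgn_minus)
qed

lemma insert_index_in_cells:
  assumes "t \<in> cells (k - 1)" "i \<in> {1..k}" "j \<in> {1, 2}"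
  shows "insert_index i j t \<in> cells k"
  using assms set_take_subset[of "i - 1" t] set_drop_subset[of "i - 1" t]
  by (auto simp: cells_def insert_index_def)

lemma slice_in_distributions:
  "p \<in> distributions k \<Longrightarrow> i \<in> {1..k} \<Longrightarrow> j \<in> {1, 2} \<Longrightarrow> slice k i j p \<in> distributions (k - 1)"
  unfolding slice_def
  by (intro restrict_in_distributions) (auto intro!: distributions_pos insert_index_in_cells)

lemma collapse_in_distributions:
  "p \<in> distributions k \<Longrightarrow> i \<in> {1..k} \<Longrightarrow> collapse k i p \<in> distributions (k - 1)"
  unfolding collapse_def
  by (intro restrict_in_distributions add_pos_pos)
     (auto intro!: distributions_pos insert_index_in_cells)

lemma DI_collapse: "DI (k - 1) (collapse k i p) = DI (k - 1) (slice k i 1 p) + DI (k - 1) (slice k i 2 p)"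
proof -
  have "sum (collapse k i p) (parity_class (k - 1) b) =
      sum (slice k i 1 p) (parity_class (k - 1) b) + sum (slice k i 2 p) (parity_class (k - 1) b)" for b
    unfolding sum.distrib[symmetric]
    by (intro sum.cong) (auto simp: collapse_def slice_def parity_class_def)
  then show ?thesis by (simp add: DI_eq)
qed

lemma directionally_collapsible_if_sgn_DI:
  assumes "\<And>k p. k \<ge> 1 \<Longrightarrow> p \<in> distributions k \<Longrightarrow> sgn (f k p) = sgn (DI k p)"
  shows "directionally_collapsible f"
  unfolding directionally_collapsible_def
proof (intro allI ballI impI)
  fix k p i
  assume k: "2 \<le> (k::nat)" and p: "p \<in> distributions k" and i: "i \<in> {1..k}"
    and eq: "sgn (f (k - 1) (slice k i 1 p)) = sgn (f (k - 1) (slice k i 2 p))"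
  have k': "k - 1 \<ge> 1" using k by simp
  have add: "sgn (x + y) = sgn x" if "sgn x = sgn y" for x y :: real
    using that by (auto simp: sgn_if split: if_splits)
  show "sgn (f (k - 1) (collapse k i p)) = sgn (f (k - 1) (slice k i 1 p))"
    using eq slice_in_distributions[OF p i] collapse_in_distributions[OF p i]
    by (simp add: assms[OF k'] DI_collapse add del: One_nat_def)
qed

theorem theorem4:
  fixes f :: "nat \<Rightarrow> (nat list \<Rightarrow> real) \<Rightarrow> real"
  assumes "property1 f" and "property2 f"
  shows "directionally_collapsible f \<longleftrightarrow>
    (\<forall>k\<ge>1. \<forall>p\<in>distributions k. sgn (f k p) = sgn (DI k p))"
  using sgn_eq_sgn_DI[OF _ assms] directionally_collapsible_if_sgn_DI[of f] by blast

end
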